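(* There exist an ordered set $\mathcal{X}$ and a class $\mathcal{F}\subseteq\mathcal{X}^{\mathcal{X}}$ such that for every $T\in\mathbb{N}$: (i) $\inf_{\mathcal{A}}\operatorname{M}_{\mathcal{A}}(T,\mathcal{F})\le 3$, but (ii) $\inf_{\mathcal{A}}\operatorname{FR}_{\mathcal{A}}(T,\mathcal{F})\ge\frac{T}{6}$, where the infima are over all (possibly randomized) learners.
   Context: $\mathbb{N}=\{1,2,\dots\}$, $[T]=\{1,\dots,T\}$. $f^t$ is the $t$-fold composition of $f$ with itself. A learner $\mathcal{A}$ is a (possibly randomized) rule that maps every finite sequence of states $x_{<t} := (x_0,\dots,x_{t-1})$ to a prediction $\mathcal{A}(x_{<t}) \in \mathcal{X}$. It may depend on $T$ and $\mathcal{F}$. Expectations below are over the learner's randomness. Expected number of mistakes in the realizable setting: $$\operatorname{M}_{\mathcal{A}}(T,\mathcal{F}) := \sup_{x_0\in\mathcal{X}}\ \sup_{f\in\mathcal{F}}\ \mathbb{E}\Big[\sum_{t=1}^T \mathbf{1}\{\mathcal{A}(x_{<t}) \neq f(x_{t-1})\}\Big],$$ where $x_t = f(x_{t-1})$ for all $t\in[T]$. Expected Flow regret: $$\operatorname{FR}_{\mathcal{A}}(T,\mathcal{F}) := \sup_{(x_0,x_1,\dots,x_T)\in\mathcal{X}^{T+1}}\Big(\mathbb{E}\Big[\sum_{t=1}^T\mathbf{1}\{\mathcal{A}(x_{<t})\ne x_t\}\Big]-\inf_{f\in\mathcal{F}}\sum_{t=1}^T\mathbf{1}\{f^t(x_0)\ne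 x_t\}\Big).$$ *)

theory Defs
  imports "HOL-Probability.Probability"
begin

text \<open>
  A randomized learner on the state set \<open>X\<close> is the law \<open>M\<close> of a random prediction rule, that is a
  probability measure on maps from finite state sequences to states. The \<open>\<sigma>\<close>-algebra is arbitrary,
  apart from containing the events that a given history is answered by a given state; a rule
  realised on any probability space with these events measurable can be pushed forward to such
  an \<open>M\<close>. Values of a rule on lists outside \<open>lists X\<close> are irrelevant.
\<close>

definition randomized_learner :: "'a set \<Rightarrow> ('a list \<Rightarrow> 'a) measure \<Rightarrow> bool" where
  "randomized_learner X M \<longleftrightarrow>
     prob_space M \<and>
     (\<forall>A\<in>space M. \<forall>xs\<in>lists X. A xs \<in> X) \<and>
     (\<forall>xs\<in>lists X. \<forall>y\<in>X. {A \<in> space M. A xs = y} \<in> sets M)"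

definition history :: "(nat \<Rightarrow> 'a) \<Rightarrow> nat \<Rightarrow> 'a list" where
  "history x t = map x [0..<t]"

definition trajectory :: "('a \<Rightarrow> 'a) \<Rightarrow> 'a \<Rightarrow> nat \<Rightarrow> 'a" where
  "trajectory f x0 t = (f ^^ t) x0"

text \<open>
  Suprema and infima are taken in \<^typ>\<open>ereal\<close>, so that none of them is a default value.
\<close>

definition expected_mistakes ::
    "'a set \<Rightarrow> ('a \<Rightarrow> 'a) set \<Rightarrow> nat \<Rightarrow> ('a list \<Rightarrow> 'a) measure \<Rightarrow> ereal" where
  "expected_mistakes X F T M =
     (SUP x0\<in>X. SUP f\<in>F.
        ereal (\<integral>A. (\<Sum>t=1..T. of_bool (A (history (trajectory f x0) t)
                                  \<noteq> f (trajectory f x0 (t - 1)))) \<partial>M))"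

definition flow_regret ::
    "'a set \<Rightarrow> ('a \<Rightarrow> 'a) set \<Rightarrow> nat \<Rightarrow> ('a list \<Rightarrow> 'a) measure \<Rightarrow> ereal" where
  "flow_regret X F T M =
     (SUP x \<in> {0..T} \<rightarrow>\<^sub>E X.
        ereal (\<integral>A. (\<Sum>t=1..T. of_bool (A (history x t) \<noteq> x t)) \<partial>M)
        - (INF f\<in>F. ereal (\<Sum>t=1..T. of_bool ((f ^^ t) (x 0) \<noteq> x t))))"

end

theory Submission imports Defs begin

text \<open>
  A state is a pair of a clock and a payload. The map with code \<open>c\<close> advances the clock; on even
  clocks its new payload is the next entry of the list coded by \<open>c\<close>, on odd clocks it is \<open>c\<close>
  itself. A realizable learner therefore sees \<open>c\<close> after at most two steps and is right from then on.

  For the flow regret, an adversary that knows the law of the learner reveals at each time a payload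
  from \<open>{0,1,2}\<close> that the learner predicts with probability at most \<open>1/3\<close>. The learner then
  errs \<open>2T/3\<close> times in expectation, whereas the map whose list is the sequence of revealed payloads
  errs only at even times, as its orbit does not depend on the payloads at even clocks.
\<close>

definition code_step :: "nat \<Rightarrow> nat \<Rightarrow> nat" where
  "code_step c s = (case prod_decode s of
     (k, n) \<Rightarrow> prod_encode (Suc k, if even k then list_decode c ! k else c))"

lemma code_step_prod_encode:
  "code_step c (prod_encode (k, n)) = prod_encode (Suc k, if even k then list_decode c ! k else c)"
  by (simp add: code_step_def)

lemma clock_trajectory: "\<exists>n. (code_step c ^^ t) (prod_encode (k, m)) = prod_encode (k + t, n)"
  by (induction t) (auto simp: code_step_prod_encode)

text \<open>The step into an odd time starts at an even clock, where the payload is overwritten by a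
  list entry. Hence \<open>m\<close> and all earlier payloads leave no trace.\<close>

lemma code_step_orbit_odd:
  assumes "odd t"
  shows "(code_step c ^^ t) (prod_encode (0, m)) = prod_encode (t, list_decode c ! (t - 1))"
proof -
  obtain s where s: "t = Suc s" "even s" using assms by (metis odd_Suc_minus_one even_Suc)
  obtain n where "(code_step c ^^ s) (prod_encode (0, m)) = prod_encode (s, n)"
    using clock_trajectory[where c=c and t=s and k=0 and m=m] by auto
  then show ?thesis using s by (simp add: code_step_prod_encode)
qed

text \<open>Of two consecutive states reached by a map, the one with even clock carries its code.\<close>

definition code_rule :: "nat list \<Rightarrow> nat" where
  "code_rule xs = (let s = xs ! (length xs - 1); (k, n) = prod_decode s in
     code_step (if even k then n else snd (prod_decode (xs ! (length xs - 2)))) s)"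

text \<open>The payload of \<open>x0\<close> is arbitrary, so both states that the rule inspects
  have to be images under the map, which forces \<open>t - 2 \<ge> 1\<close>.\<close>

lemma code_rule_correct:
  assumes "t \<ge> 3"
  shows "code_rule (history (trajectory (code_step c) x0) t)
           = code_step c (trajectory (code_step c) x0 (t - 1))"
proof -
  obtain s where s: "t = s + 3" using assms by (metis le_add_diff_inverse2)
  let ?f = "code_step c"
  obtain k m where x0: "x0 = prod_encode (k, m)" by (metis prod_decode_inverse surj_pair)
  obtain n where n: "(?f ^^ s) x0 = prod_encode (k + s, n)"
    using clock_trajectory x0 by blast
  \<comment> \<open>An index beyond the list yields an unspecified value, but one determined by
    \<open>c\<close> and the clock, so a rule that knows \<open>c\<close> reproduces it.\<close>
  have "(?f ^^ Suc s) x0 = prod_encode (Suc (k + s), if even (k + s) then list_decode c ! (k + s) else c)"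
    by (simp add: n code_step_prod_encode)
  moreover from this have "(?f ^^ Suc (Suc s)) x0 = prod_encode (Suc (Suc (k + s)),
      if even (k + s) then c else list_decode c ! (Suc (k + s)))"
    by (simp add: code_step_prod_encode)
  moreover have "history (trajectory ?f x0) t ! (t - 1) = (?f ^^ Suc (Suc s)) x0"
      "history (trajectory ?f x0) t ! (t - 2) = (?f ^^ Suc s) x0"
      "length (history (trajectory ?f x0) t) = t"
      "trajectory ?f x0 (t - 1) = (?f ^^ Suc (Suc s)) x0"
    unfolding history_def trajectory_def s by (simp_all add: numeral_eq_Suc nth_append del: funpow.simps)
  ultimately show ?thesis
    unfolding code_rule_def by (auto simp: Let_def simp del: funpow.simps)
qed

lemma code_rule_mistakes:
  "(\<Sum>t=1..T. of_bool (code_rule (history (trajectory (code_step c) x0) t)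
      \<noteq> code_step c (trajectory (code_step c) x0 (t - 1)))) \<le> (2::real)"
proof -
  let ?P = "\<lambda>t. code_rule (history (trajectory (code_step c) x0) t)
      \<noteq> code_step c (trajectory (code_step c) x0 (t - 1))"
  have "{t \<in> {1..T}. ?P t} \<subseteq> {1, 2}"
  proof
    fix t assume "t \<in> {t \<in> {1..T}. ?P t}"
    then have "1 \<le> t" "\<not> 3 \<le> t" using code_rule_correct by auto
    then show "t \<in> {1, 2}" by auto
  qed
  then have "{1..T} \<inter> Collect ?P \<subseteq> {1, 2}" by blast
  then have "card ({1..T} \<inter> Collect ?P) \<le> card {1, 2::nat}" by (intro card_mono) auto
  moreover have "(\<Sum>t=1..T. of_bool (?P t)) = real (card ({1..T} \<inter> Collect ?P))"
    by simp
  ultimately show ?thesis by simp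
qed

text \<open>A deterministic rule enters as a point mass; the discrete \<sigma>-algebra makes every
  event measurable.\<close>

lemma randomized_learner_return:
  "randomized_learner UNIV (return (count_space UNIV) A)"
  by (auto simp: randomized_learner_def intro!: prob_space_return)

lemma expected_mistakes_code_rule:
  "expected_mistakes UNIV (range code_step) T (return (count_space UNIV) code_rule) \<le> 3"
  unfolding expected_mistakes_def
proof (intro SUP_least)
  fix x0 f assume "f \<in> range code_step"
  then obtain c where f: "f = code_step c" by auto
  have "(\<integral>A. (\<Sum>t=1..T. of_bool (A (history (trajectory f x0) t) \<noteq> f (trajectory f x0 (t - 1))))
      \<partial>return (count_space UNIV) code_rule) \<le> (2::real)"
    using code_rule_mistakes[of c x0 T] by (subst integral_return) (auto simp: f)
  then show "ereal (\<integral>A. (\<Sum>t=1..T. of_bool (A (history (trajectory f x0) t)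
      \<noteq> f (trajectory f x0 (t - 1)))) \<partial>return (count_space UNIV) code_rule) \<le> 3"
    by (simp add: order_trans)
qed

text \<open>Pigeonhole: the \<open>K\<close> events are disjoint, so their probabilities sum to at
  most 1 and cannot all exceed \<open>1 / K\<close>.\<close>

lemma unlikely_prediction:
  fixes X :: "'a set" and y :: "nat \<Rightarrow> 'a"
  assumes M: "randomized_learner X M" and xs: "xs \<in> lists X"
    and y: "inj y" "range y \<subseteq> X" and K: "K > 0"
  shows "\<exists>a<K. measure M {A \<in> space M. A xs = y a} \<le> 1 / real K"
proof (rule ccontr)
  let ?E = "\<lambda>a. {A \<in> space M. A xs = y a}"
  assume "\<not> ?thesis"
  then have gt: "\<And>a. a < K \<Longrightarrow> 1 / real K < measure M (?E a)" by auto
  interpret prob_space M using M by (simp add: randomized_learner_def)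
  have "?E a \<in> sets M" for a using M xs y(2) unfolding randomized_learner_def by blast
  then have "?E ` {..<K} \<subseteq> sets M" by blast
  moreover have "disjoint_family_on ?E {..<K}"
    using y(1) by (auto simp: disjoint_family_on_def inj_def)
  ultimately have "measure M (\<Union>a<K. ?E a) = (\<Sum>a<K. measure M (?E a))"
    by (intro finite_measure_finite_Union) auto
  also have "\<dots> > (\<Sum>a<K. 1 / real K)" using K gt by (intro sum_strict_mono) auto
  finally show False using prob_le_1[of "\<Union>a<K. ?E a"] K by simp
qed

text \<open>The adversary's next state depends on the states already revealed. Recursion on the list
  of these avoids defining a sequence in terms of its own prefixes.\<close>

primrec greedy_history :: "(nat list \<Rightarrow> 'a) \<Rightarrow> (nat \<Rightarrow> 'a \<Rightarrow> nat) \<Rightarrow> nat \<Rightarrow> nat list" where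
  "greedy_history g e 0 = []"
| "greedy_history g e (Suc t) = greedy_history g e t @ [e t (g (greedy_history g e t))]"

lemma greedy_history_eq_history:
  "greedy_history g e t = history (\<lambda>t. e t (g (greedy_history g e t))) t"
  by (induction t) (auto simp: history_def)

text \<open>Linearity of expectation: each round contributes its error probability, at least
  \<open>1 - p\<close>.\<close>

lemma learner_expected_errors:
  fixes x :: "nat \<Rightarrow> 'a"
  assumes M: "randomized_learner X M" and x: "\<And>t. t \<le> T \<Longrightarrow> x t \<in> X"
    and p: "\<And>t. t \<in> {1..T} \<Longrightarrow> measure M {A \<in> space M. A (history x t) = x t} \<le> p"
  shows "(\<integral>A. (\<Sum>t=1..T. of_bool (A (history x t) \<noteq> x t)) \<partial>M) \<ge> real T * (1 - p)"
proof -
  interpret prob_space M using M by (simp add: randomized_learner_def)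
  let ?E = "\<lambda>t. {A \<in> space M. A (history x t) = x t}"
  have E: "?E t \<in> sets M" if "t \<in> {1..T}" for t
  proof -
    have "history x t \<in> lists X" using x that by (auto simp: history_def)
    then show ?thesis using M x that by (auto simp: randomized_learner_def)
  qed
  \<comment> \<open>Errors are expressed through correct answers, the events whose measurability a
    learner guarantees.\<close>
  have "(\<integral>A. (\<Sum>t=1..T. of_bool (A (history x t) \<noteq> x t)) \<partial>M)
      = (\<integral>A. (\<Sum>t=1..T. 1 - indicator (?E t) A) \<partial>M)"
    by (intro Bochner_Integration.integral_cong sum.cong) (auto simp: indicator_def)
  also have "\<dots> = (\<Sum>t=1..T. 1 - measure M (?E t))"
    using E by (subst Bochner_Integration.integral_sum)
      (auto intro!: sum.cong simp: prob_space emeasure_eq_measure less_top[symmetric])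
  also have "\<dots> \<ge> (\<Sum>t=1..T. 1 - p)" using p by (intro sum_mono) fastforce
  finally show ?thesis by simp
qed

lemma flow_errors_of_code:
  assumes "\<And>t. t \<in> {0..T} \<Longrightarrow> x t = prod_encode (t, a t)"
  shows "\<exists>f\<in>range code_step. (\<Sum>t=1..T. of_bool ((f ^^ t) (x 0) \<noteq> x t)) \<le> real T / 2"
proof -
  \<comment> \<open>The shift puts \<open>a t\<close> at index \<open>t - 1\<close>, the entry that
    the orbit shows at an odd time \<open>t\<close>.\<close>
  define c where "c = list_encode (map (\<lambda>t. a (Suc t)) [0..<T])"
  let ?P = "\<lambda>t. (code_step c ^^ t) (x 0) \<noteq> x t"
  have "(\<Sum>t=1..T. of_bool (?P t)) \<le> (\<Sum>t=1..T. of_bool (even t) :: real)"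
  proof (intro sum_mono)
    fix t assume t: "t \<in> {1..T}"
    have "\<not> ?P t" if "odd t"
      using t that assms[of 0] assms[of t] by (auto simp: code_step_orbit_odd c_def)
    then show "of_bool (?P t) \<le> (of_bool (even t) :: real)" by auto
  qed
  also have "\<dots> = real (T div 2)" by (induction T) auto
  also have "\<dots> \<le> real T / 2" by linarith
  finally show ?thesis by blast
qed

text \<open>The constant is 2/3 - 1/2 = 1/6: the learner's expected error rate minus a bound on that
  of a well-chosen map.\<close>

lemma flow_regret_code_step:
  assumes M: "randomized_learner UNIV M"
  shows "flow_regret UNIV (range code_step) T M \<ge> ereal (real T / 6)"
proof -
  let ?e = "\<lambda>t n. prod_encode (t, n)"
  \<comment> \<open>The candidates share the clock \<open>length xs\<close>, the time of the next
    state, and differ only in the payload.\<close>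
  have "\<exists>a. measure M {A \<in> space M. A xs = ?e (length xs) a} \<le> 1 / 3" for xs
    using unlikely_prediction[OF M, of xs "?e (length xs)" 3] by (auto simp: inj_def)
  then have "\<forall>xs. \<exists>a. measure M {A \<in> space M. A xs = ?e (length xs) a} \<le> 1 / 3" by blast
  from choice[OF this] obtain g
    where g: "\<And>xs. measure M {A \<in> space M. A xs = ?e (length xs) (g xs)} \<le> 1 / 3"
    by blast
  define y where "y t = ?e t (g (greedy_history g ?e t))" for t
  \<comment> \<open>The supremum in \<open>flow_regret\<close> ranges over extensional functions on
    \<open>{0..T}\<close>.\<close>
  define x where "x = restrict y {0..T}"
  have hist: "history x t = greedy_history g ?e t" if "t \<le> T" for t
  proof -
    have "history x t = history y t" using that by (auto simp: history_def x_def)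
    then show ?thesis using greedy_history_eq_history[of g ?e t] by (simp add: y_def[abs_def])
  qed
  have "real T * (1 - 1 / 3) \<le> (\<integral>A. (\<Sum>t=1..T. of_bool (A (history x t) \<noteq> x t)) \<partial>M)"
  proof (intro learner_expected_errors[OF M])
    fix t assume t: "t \<in> {1..T}"
    have "length (history x t) = t" by (simp add: history_def)
    then show "measure M {A \<in> space M. A (history x t) = x t} \<le> 1 / 3"
      using t g[of "history x t"] by (simp add: x_def[THEN fun_cong, of t] y_def hist)
  qed auto
  moreover obtain f where f: "f \<in> range code_step"
      and le: "(\<Sum>t=1..T. of_bool ((f ^^ t) (x 0) \<noteq> x t)) \<le> real T / 2"
    using flow_errors_of_code[of T x "\<lambda>t. g (greedy_history g ?e t)"] by (auto simp: x_def y_def)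
  moreover have "(INF f\<in>range code_step. ereal (\<Sum>t=1..T. of_bool ((f ^^ t) (x 0) \<noteq> x t)))
      \<le> ereal (real T / 2)"
    by (rule INF_lower2[OF f]) (use le in simp)
  ultimately have "ereal (real T * (1 - 1 / 3)) - ereal (real T / 2)
      \<le> ereal (\<integral>A. (\<Sum>t=1..T. of_bool (A (history x t) \<noteq> x t)) \<partial>M)
        - (INF f\<in>range code_step. ereal (\<Sum>t=1..T. of_bool ((f ^^ t) (x 0) \<noteq> x t)))"
    by (intro ereal_minus_mono) simp_all
  also have "\<dots> \<le> flow_regret UNIV (range code_step) T M"
    unfolding flow_regret_def by (rule SUP_upper) (auto simp: x_def restrict_PiE_iff)
  finally show ?thesis by (simp add: field_simps)
qed

theorem theorem18:
  "\<exists>(X :: nat set) (r :: nat rel) (F :: (nat \<Rightarrow> nat) set).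
     linear_order_on X r \<and> F \<subseteq> X \<rightarrow>\<^sub>E X \<and>
     (\<forall>T::nat. T \<ge> 1 \<longrightarrow>
        (INF M\<in>{M. randomized_learner X M}. expected_mistakes X F T M) \<le> 3 \<and>
        (INF M\<in>{M. randomized_learner X M}. flow_regret X F T M) \<ge> ereal (real T / 6))"
proof (intro exI conjI allI impI)
  show "linear_order_on UNIV {(m, n::nat). m \<le> n}"
    by (auto simp: linear_order_on_def partial_order_on_def preorder_on_def refl_on_def
        trans_def antisym_def total_on_def)
  show "range code_step \<subseteq> UNIV \<rightarrow>\<^sub>E UNIV" by auto
next
  fix T :: nat
  show "(INF M\<in>{M. randomized_learner UNIV M}. expected_mistakes UNIV (range code_step) T M) \<le> 3"
    by (rule INF_lower2) (use randomized_learner_return expected_mistakes_code_rule in auto)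
  show "(INF M\<in>{M. randomized_learner UNIV M}. flow_regret UNIV (range code_step) T M)
      \<ge> ereal (real T / 6)"
    by (intro INF_greatest) (simp add: flow_regret_code_step)
qed

end
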